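(* Let $n\in\mathbb{N}$ and let $E_n=(\mathbb{R}^n,\|\cdot\|_2)$ denote the $n$-dimensional Euclidean space. If $Q$ is any projection from $\mathcal{C}^1_0(B_{E_n})$ onto $\mathcal{P}({}^2E_n)$, then $$\|Q\|\geq C\left(n-2\sqrt{2}\right)^{1/5},\qquad\text{where } C:=\frac{2}{5}\left(\frac{\sqrt{2}-1}{3}\cdot\frac{\pi}{72}\right)^{1/5}.$$ In particular, the same estimate holds for every projection $Q$ from $\mathrm{Lip}_0(B_{E_n})$ onto $\mathcal{P}({}^2E_n)$.
   Context: All spaces are over the real scalars. $B_{E_n}$ is the closed unit ball of $E_n$ and $B_{E_n}^{\mathsf{o}}$ the open unit ball. $\mathrm{Lip}_0(B_{E_n})$ is the Banach space of all Lipschitz functions $f\colon B_{E_n}\to\mathbb{R}$ with $f(0)=0$, with norm the best Lipschitz constant $\|f\|_{\mathrm{Lip}_0}=\mathrm{Lip}(f)=\sup\{|f(x)-f(y)|/\|x-y\|_2 : x\neq y\in B_{E_n}\}$. $\mathcal{C}^1_0(B_{E_n})$ is the set of all continuous $f\colon B_{E_n}\to\mathbb{R}$ with $f(0)=0$ that are continuously differentiable on $B_{E_n}^{\mathsf{o}}$ and whose gradient $\nabla f$ is uniformly continuous on $B_{E_n}^{\mathsf{o}}$. It is a closed subspace of $\mathrm{Lip}_0(B_{E_n})$, endowed with the norm $\|f\|_{\mathrm{Lip}_0}=\|\nabla f\|_\infty$. $\mathcal{P}({}^2E_n)$ is the space of $2$-homogeneous polynomials on $E_n$, i.e. functions $P(x)=M(x,x)$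 with $M$ a bilinear form on $E_n$. It is regarded as a subspace of $\mathcal{C}^1_0(B_{E_n})\subseteq \mathrm{Lip}_0(B_{E_n})$ via the restriction map $P\mapsto P|_{B_{E_n}}$. A projection is a bounded linear idempotent operator; "onto" specifies its range. $\|Q\|$ is the operator norm with respect to the norm $\|\cdot\|_{\mathrm{Lip}_0}$ on both the domain and the range. The fifth root is the real one (so the right-hand side is negative when $n-2\sqrt2<0$). *)

theory Defs
  imports "HOL-Analysis.Analysis"
begin

text \<open>
  A real function on the closed unit ball is represented by its extension by zero
  to the whole space. This makes the representation unique and keeps the function spaces
  below closed under the pointwise operations.
\<close>

definition ball_restrict :: "('a::real_normed_vector \<Rightarrow> real) \<Rightarrow> 'a \<Rightarrow> real" where
  "ball_restrict f = (\<lambda>x. if x \<in> cball 0 1 then f x else 0)"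

definition ball_funs :: "('a::real_normed_vector \<Rightarrow> real) set" where
  "ball_funs = {f. \<forall>x. x \<notin> cball 0 1 \<longrightarrow> f x = 0}"

text \<open>The supremum is only meaningful for functions that are Lipschitz on the ball.\<close>

definition lip_norm :: "('a::real_normed_vector \<Rightarrow> real) \<Rightarrow> real" where
  "lip_norm f = Sup {\<bar>f x - f y\<bar> / norm (x - y) | x y. x \<in> cball 0 1 \<and> y \<in> cball 0 1 \<and> x \<noteq> y}"

definition Lip0 :: "('a::real_normed_vector \<Rightarrow> real) set" where
  "Lip0 = {f \<in> ball_funs. (\<exists>L. L-lipschitz_on (cball 0 1) f) \<and> f 0 = 0}"

text \<open>
  Differentiability is only required in the open ball, so the extension by zero is irrelevant
  here. Gradients are unique, so the function \<open>g\<close> below is the gradient of \<open>f\<close> there.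
\<close>

definition C10 :: "('a::real_inner \<Rightarrow> real) set" where
  "C10 = {f \<in> ball_funs. continuous_on (cball 0 1) f \<and> f 0 = 0 \<and>
     (\<exists>g. (\<forall>x\<in>ball 0 1. GDERIV f x :> g x) \<and>
          continuous_on (ball 0 1) g \<and> uniformly_continuous_on (ball 0 1) g)}"

definition hom_poly2 :: "('a::real_vector \<Rightarrow> real) set" where
  "hom_poly2 = {P. \<exists>M. bilinear M \<and> P = (\<lambda>x. M x x)}"

definition hom_poly2_ball :: "('a::real_normed_vector \<Rightarrow> real) set" where
  "hom_poly2_ball = ball_restrict ` hom_poly2"

text \<open>
  Operators act on all functions, but only their values on the space \<open>X\<close> matter.
\<close>

definition projection_onto ::
  "('a::real_normed_vector \<Rightarrow> real) set \<Rightarrow> ('a \<Rightarrow> real) set \<Rightarrow> (('a \<Rightarrow> real) \<Rightarrow> ('a \<Rightarrow> real)) \<Rightarrow> bool"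
where
  "projection_onto X Y Q \<longleftrightarrow>
     (\<forall>f\<in>X. Q f \<in> X) \<and>
     (\<forall>f\<in>X. \<forall>g\<in>X. Q (\<lambda>x. f x + g x) = (\<lambda>x. Q f x + Q g x)) \<and>
     (\<forall>c. \<forall>f\<in>X. Q (\<lambda>x. c * f x) = (\<lambda>x. c * Q f x)) \<and>
     (\<exists>K. \<forall>f\<in>X. lip_norm (Q f) \<le> K * lip_norm f) \<and>
     (\<forall>f\<in>X. Q (Q f) = Q f) \<and>
     Q ` X = Y"

definition op_norm ::
  "('a::real_normed_vector \<Rightarrow> real) set \<Rightarrow> (('a \<Rightarrow> real) \<Rightarrow> ('a \<Rightarrow> real)) \<Rightarrow> real" where
  "op_norm X Q = Sup {lip_norm (Q f) | f. f \<in> X \<and> lip_norm f \<le> 1}"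


text \<open>
  The next two inclusions show that \<open>lip_norm\<close> is finite on all the spaces involved and that
  \<open>Q ` X = hom_poly2_ball\<close> is compatible with \<open>Q\<close> mapping \<open>X\<close> to itself.
\<close>

lemma C10_subset_Lip0: "C10 \<subseteq> (Lip0 :: ('a::euclidean_space \<Rightarrow> real) set)"
proof
  fix f :: "'a \<Rightarrow> real" assume f: "f \<in> C10"
  then obtain g where g: "\<And>x. x \<in> ball 0 1 \<Longrightarrow> GDERIV f x :> g x"
    and u: "uniformly_continuous_on (ball 0 1) g"
    unfolding C10_def by blast
  from bounded_uniformly_continuous_image[OF u bounded_ball] obtain L
    where L: "\<And>x. x \<in> ball 0 1 \<Longrightarrow> norm (g x) \<le> L"
    unfolding bounded_iff by blast
  have L0: "0 \<le> L" using order_trans[OF norm_ge_zero L[of 0]] by simp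
  have "L-lipschitz_on (ball 0 1) f"
  proof (rule bounded_derivative_imp_lipschitz[where f' = "\<lambda>x h. inner h (g x)"])
    fix x :: 'a assume x: "x \<in> ball 0 1"
    show "(f has_derivative (\<lambda>h. inner h (g x))) (at x within ball 0 1)"
      using g[OF x] unfolding gderiv_def by (rule has_derivative_at_withinI)
    show "onorm (\<lambda>h. inner h (g x)) \<le> L"
    proof (rule onorm_le)
      fix h
      have "norm (inner h (g x)) \<le> norm h * norm (g x)"
        using Cauchy_Schwarz_ineq2 by simp
      also have "\<dots> \<le> norm h * L" using L[OF x] by (intro mult_left_mono) auto
      finally show "norm (inner h (g x)) \<le> L * norm h" by (simp add: mult.commute)
    qed
  qed (use L0 in auto)
  moreover have "continuous_on (cball 0 1) f" using f by (simp add: C10_def)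
  moreover have "closure (ball 0 1) = cball (0::'a) 1" by (rule closure_ball) simp
  ultimately have "L-lipschitz_on (cball 0 1) f"
    using lipschitz_on_closure[of L "ball 0 1" f] by simp
  then show "f \<in> Lip0" using f by (auto simp: C10_def Lip0_def)
qed

lemma hom_poly2_ball_subset_C10:
  "hom_poly2_ball \<subseteq> (C10 :: ('a::euclidean_space \<Rightarrow> real) set)"
proof
  fix f :: "'a \<Rightarrow> real" assume "f \<in> hom_poly2_ball"
  then obtain M where M: "bilinear M" and f: "f = ball_restrict (\<lambda>x. M x x)"
    by (auto simp: hom_poly2_ball_def hom_poly2_def)
  have bb: "bounded_bilinear M" using M by (simp add: bilinear_conv_bounded_bilinear)
  then interpret bounded_bilinear M .
  define g where "g x = (\<Sum>b\<in>Basis. (M x b + M b x) *\<^sub>R b)" for x :: 'a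
  have gh: "inner h (g x) = M x h + M h x" for x h
  proof -
    have 1: "linear (\<lambda>h. M x h + M h x)"
      by (intro linear_compose_add linear_conv_bounded_linear[THEN iffD2]
          bounded_linear_right bounded_linear_left)
    have "M x h + M h x = (\<Sum>b\<in>Basis. inner h b * (M x b + M b x))"
      using Linear_Algebra.linear_componentwise[OF 1, of h 1] by simp
    then show ?thesis by (simp only: g_def inner_sum_right inner_scaleR_right mult.commute)
  qed
  have gl: "bounded_linear g"
    unfolding g_def
    by (intro bounded_linear_sum bounded_linear_scaleR_const bounded_linear_add
        bounded_linear_left bounded_linear_right)
  have D: "GDERIV f x :> g x" if "x \<in> ball 0 1" for x
  proof -
    have "((\<lambda>x. M x x) has_derivative (\<lambda>h. M x h + M h x)) (at x)"
      using FDERIV[OF has_derivative_ident has_derivative_ident] .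
    then have "(f has_derivative (\<lambda>h. M x h + M h x)) (at x)"
      by (rule has_derivative_transform_within_open[of _ _ _ _ "ball 0 1"])
        (use that in \<open>auto simp: f ball_restrict_def\<close>)
    then show ?thesis by (simp add: gderiv_def gh)
  qed
  have c: "continuous_on (cball 0 1) (\<lambda>x. M x x)"
    by (intro continuous_on continuous_on_id)
  have "continuous_on (cball 0 1) f"
    by (rule continuous_on_eq[OF c]) (simp add: f ball_restrict_def)
  moreover have "uniformly_continuous_on (ball 0 1) g"
    by (rule bounded_linear.uniformly_continuous_on[OF gl uniformly_continuous_on_id])
  moreover have "continuous_on (ball 0 1) g"
    using gl by (rule linear_continuous_on)
  moreover have "f 0 = 0" "f \<in> ball_funs"
    by (simp_all add: f ball_restrict_def ball_funs_def zero_left)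
  ultimately show "f \<in> C10"
    unfolding C10_def using D by blast
qed

end

theory Submission
  imports Defs
begin

text \<open>
  The bound follows from a stronger one, of order \<open>sqrt n\<close>, in
  \<open>op_norm_projection_lower_bound\<close>. The idea is to write every monomial
  \<open>x\<^sub>i x\<^sub>j\<close> with \<open>i \<noteq> j\<close> as an average of functions that are individually much
  smaller than the quadratic forms hidden in them.

  For a sign vector \<open>u\<close> consider the Riesz product
  \<open>R\<^sub>u(x) = \<Prod>\<^sub>k (1 + \<i> u\<^sub>k x\<^sub>k)\<close>. Expanding it gives one monomial for each set of
  coordinates, and averaging against \<open>u\<^sub>i u\<^sub>j\<close> over all signs isolates the
  monomial of \<open>{i, j}\<close>: the average is exactly \<open>- x\<^sub>i x\<^sub>j\<close>
  (\<open>sum_signs_riesz\<close>). The factor \<open>\<i>\<close> keeps the product small: its modulus is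
  \<open>\<Prod>\<^sub>k sqrt (1 + x\<^sub>k\<^sup>2) \<le> exp (|x|\<^sup>2 / 2)\<close>, so on the unit ball each partial
  derivative of \<open>Re R\<^sub>u\<close> is at most \<open>sqrt e\<close>, and \<open>Re R\<^sub>u\<close> has Lipschitz constant at
  most \<open>sqrt (n e)\<close> (\<open>test_fun_properties\<close>). By contrast its part of degree two,
  \<open>- \<Sum>\<^sub>i\<^sub><\<^sub>j u\<^sub>i u\<^sub>j x\<^sub>i x\<^sub>j\<close>, has Lipschitz constant of order \<open>n\<close>.

  A projection \<open>Q\<close> must reveal this gap on average. Let \<open>q\<^sub>u\<close> be the image of the
  normalised function \<open>(Re R\<^sub>u - 1) / sqrt (n e)\<close>; it is a quadratic form of
  Lipschitz norm at most \<open>\<parallel>Q\<parallel>\<close>. As \<open>Q\<close> fixes \<open>x\<^sub>i x\<^sub>j\<close>, the average of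
  \<open>u\<^sub>i u\<^sub>j q\<^sub>u\<close> is \<open>- x\<^sub>i x\<^sub>j / sqrt (n e)\<close>, and comparing the coefficients of
  \<open>x\<^sub>i x\<^sub>j\<close> and summing over \<open>i \<noteq> j\<close> makes the average over \<open>u\<close> of
  \<open>\<Sum>\<^sub>i\<^sub>\<noteq>\<^sub>j u\<^sub>i u\<^sub>j A\<^sub>u(i,j)\<close>, with \<open>A\<^sub>u\<close> the symmetric matrix of \<open>q\<^sub>u\<close>, equal to
  \<open>- n (n - 1) / (2 sqrt (n e))\<close>. But this sum is \<open>n q\<^sub>u(u / sqrt n) - tr A\<^sub>u\<close>,
  which is at most \<open>n \<parallel>Q\<parallel>\<close> in absolute value (\<open>off_diagonal_sum_le\<close>). Hence
  \<open>\<parallel>Q\<parallel> \<ge> (n - 1) / (2 sqrt (n e))\<close>.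

  The argument applies to every linear space between \<open>C10\<close> and \<open>Lip0\<close>, because the test
  functions are polynomials and so belong to the smaller space.
\<close>

section \<open>The Lipschitz norm and the operator norm\<close>

lemma Lip0_diff_le_lip_norm:
  fixes f :: "'a::real_normed_vector \<Rightarrow> real"
  assumes f: "f \<in> Lip0" and x: "x \<in> cball 0 1" and y: "y \<in> cball 0 1"
  shows "\<bar>f x - f y\<bar> \<le> lip_norm f * norm (x - y)"
proof (cases "x = y")
  case False
  let ?S = "{\<bar>f x - f y\<bar> / norm (x - y) | x y. x \<in> cball 0 1 \<and> y \<in> cball 0 1 \<and> x \<noteq> y}"
  obtain L where L: "L-lipschitz_on (cball 0 1) f" using f by (auto simp: Lip0_def)
  have "bdd_above ?S"
  proof (rule bdd_aboveI[of _ L])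
    fix z assume "z \<in> ?S"
    then obtain a b where z: "z = \<bar>f a - f b\<bar> / norm (a - b)"
      and ab: "a \<in> cball 0 1" "b \<in> cball 0 1" "a \<noteq> b" by blast
    then show "z \<le> L"
      using lipschitz_onD[OF L ab(1,2)] by (simp add: dist_norm divide_le_eq)
  qed
  then have "\<bar>f x - f y\<bar> / norm (x - y) \<le> lip_norm f"
    unfolding lip_norm_def using x y False by (intro cSup_upper) auto
  then show ?thesis using False by (simp add: divide_le_eq)
qed simp

lemma lip_norm_le:
  fixes f :: "real ^ 'n \<Rightarrow> real"
  assumes L: "L-lipschitz_on (cball 0 1) f"
  shows "lip_norm f \<le> L"
  unfolding lip_norm_def
proof (rule cSup_least)
  have "axis undefined 1 \<in> cball (0::real^'n) 1" "axis undefined 1 \<noteq> (0::real^'n)"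
    by (simp_all add: axis_eq_0_iff)
  moreover have "0 \<in> cball (0::real^'n) 1" by simp
  ultimately show "{\<bar>f x - f y\<bar> / norm (x - y) | x y.
      x \<in> cball 0 1 \<and> y \<in> cball 0 1 \<and> x \<noteq> y} \<noteq> {}" by blast
next
  fix z assume "z \<in> {\<bar>f x - f y\<bar> / norm (x - y) | x y. x \<in> cball 0 1 \<and> y \<in> cball 0 1 \<and> x \<noteq> y}"
  then obtain a b where z: "z = \<bar>f a - f b\<bar> / norm (a - b)"
    and ab: "a \<in> cball 0 1" "b \<in> cball 0 1" "a \<noteq> b" by blast
  then show "z \<le> L"
    using lipschitz_onD[OF L ab(1,2)] by (simp add: dist_norm divide_le_eq)
qed

lemma lip_norm_nonneg:
  fixes f :: "real ^ 'n \<Rightarrow> real"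
  assumes "f \<in> Lip0"
  shows "0 \<le> lip_norm f"
proof -
  have "0 \<le> \<bar>f (axis undefined 1) - f 0\<bar>" by simp
  also have "\<dots> \<le> lip_norm f * norm (axis undefined (1::real) - (0 :: real ^ 'n))"
    by (rule Lip0_diff_le_lip_norm[OF assms]) auto
  finally show ?thesis by simp
qed

text \<open>
  The supremum defining \<open>op_norm\<close> says nothing unless the set is bounded above; this is
  where the boundedness of a projection enters.
\<close>

lemma lip_norm_le_op_norm:
  fixes Q :: "(real ^ 'n \<Rightarrow> real) \<Rightarrow> (real ^ 'n \<Rightarrow> real)"
  assumes Q: "projection_onto X Y Q" and X: "X \<subseteq> Lip0" and f: "f \<in> X" "lip_norm f \<le> 1"
  shows "lip_norm (Q f) \<le> op_norm X Q"
proof -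
  obtain K where K: "\<And>f. f \<in> X \<Longrightarrow> lip_norm (Q f) \<le> K * lip_norm f"
    using Q unfolding projection_onto_def by blast
  have "bdd_above {lip_norm (Q f) | f. f \<in> X \<and> lip_norm f \<le> 1}"
  proof (rule bdd_aboveI[of _ "\<bar>K\<bar>"])
    fix z assume "z \<in> {lip_norm (Q f) | f. f \<in> X \<and> lip_norm f \<le> 1}"
    then obtain g where g: "g \<in> X" "lip_norm g \<le> 1" and z: "z = lip_norm (Q g)" by blast
    have g0: "0 \<le> lip_norm g" using g X lip_norm_nonneg by blast
    have "z \<le> K * lip_norm g" using K g z by simp
    also have "\<dots> \<le> \<bar>K\<bar> * lip_norm g" using g0 by (intro mult_right_mono) auto
    also have "\<dots> \<le> \<bar>K\<bar> * 1" using g by (intro mult_left_mono) auto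
    finally show "z \<le> \<bar>K\<bar>" by simp
  qed
  then show ?thesis unfolding op_norm_def using f by (intro cSup_upper) auto
qed

section \<open>Linear operators on the function spaces\<close>

definition fun_subspace :: "('a \<Rightarrow> real) set \<Rightarrow> bool" where
  "fun_subspace X \<longleftrightarrow> (\<lambda>x. 0) \<in> X \<and> (\<forall>f\<in>X. \<forall>g\<in>X. (\<lambda>x. f x + g x) \<in> X) \<and>
     (\<forall>c. \<forall>f\<in>X. (\<lambda>x. c * f x) \<in> X)"

lemma fun_subspace_Lip0: "fun_subspace (Lip0 :: ('a::real_normed_vector \<Rightarrow> real) set)"
  unfolding fun_subspace_def
proof (intro conjI ballI allI)
  show "(\<lambda>x. 0) \<in> (Lip0 :: ('a \<Rightarrow> real) set)"
    by (auto simp: Lip0_def ball_funs_def intro!: exI[of _ 0] lipschitz_onI)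
next
  fix f g :: "'a \<Rightarrow> real" assume "f \<in> Lip0" "g \<in> Lip0"
  then show "(\<lambda>x. f x + g x) \<in> Lip0"
    by (auto simp: Lip0_def ball_funs_def intro: lipschitz_on_add)
next
  fix c and f :: "'a \<Rightarrow> real" assume "f \<in> Lip0"
  then show "(\<lambda>x. c * f x) \<in> Lip0"
    by (auto simp: Lip0_def ball_funs_def intro: lipschitz_on_cmult_real)
qed

lemma C10I:
  assumes "f \<in> ball_funs" "continuous_on (cball 0 1) f" "f 0 = 0"
    and "uniformly_continuous_on (ball 0 1) g" "\<And>x. x \<in> ball 0 1 \<Longrightarrow> GDERIV f x :> g x"
  shows "f \<in> C10"
  using assms uniformly_continuous_imp_continuous unfolding C10_def by blast

lemma fun_subspace_C10: "fun_subspace (C10 :: ('a::real_inner \<Rightarrow> real) set)"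
  unfolding fun_subspace_def
proof (intro conjI ballI allI)
  show "(\<lambda>x. 0) \<in> (C10 :: ('a \<Rightarrow> real) set)"
    by (rule C10I[of _ "\<lambda>_. 0"])
      (auto simp: ball_funs_def GDERIV_const uniformly_continuous_on_const)
next
  fix f g :: "'a \<Rightarrow> real" assume f: "f \<in> C10" and g: "g \<in> C10"
  obtain a where a: "\<And>x. x \<in> ball 0 1 \<Longrightarrow> GDERIV f x :> a x"
    "uniformly_continuous_on (ball 0 1) a" using f unfolding C10_def by blast
  obtain b where b: "\<And>x. x \<in> ball 0 1 \<Longrightarrow> GDERIV g x :> b x"
    "uniformly_continuous_on (ball 0 1) b" using g unfolding C10_def by blast
  have "uniformly_continuous_on (ball 0 1) (\<lambda>x. a x + b x)"
    by (intro uniformly_continuous_on_add a b)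
  moreover have "GDERIV (\<lambda>x. f x + g x) x :> a x + b x" if "x \<in> ball 0 1" for x
    by (intro GDERIV_add a b that)
  ultimately show "(\<lambda>x. f x + g x) \<in> C10"
    using f g by (intro C10I) (auto simp: C10_def ball_funs_def intro: continuous_on_add)
next
  fix c and f :: "'a \<Rightarrow> real" assume f: "f \<in> C10"
  obtain a where a: "\<And>x. x \<in> ball 0 1 \<Longrightarrow> GDERIV f x :> a x"
    "uniformly_continuous_on (ball 0 1) a" using f unfolding C10_def by blast
  have "uniformly_continuous_on (ball 0 1) (\<lambda>x. c *\<^sub>R a x)"
    by (intro uniformly_continuous_on_cmul a)
  moreover have "GDERIV (\<lambda>x. c * f x) x :> c *\<^sub>R a x" if "x \<in> ball 0 1" for x
    using GDERIV_mult[OF GDERIV_const[of c] a(1)[OF that]] by simp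
  ultimately show "(\<lambda>x. c * f x) \<in> C10"
    using f by (intro C10I) (auto simp: C10_def ball_funs_def intro: continuous_on_mult_left)
qed

lemma projection_onto_sum:
  assumes Q: "projection_onto X Y Q" and X: "fun_subspace X" and "finite I"
    and F: "\<And>u. u \<in> I \<Longrightarrow> F u \<in> X"
  shows "(\<lambda>x. \<Sum>u\<in>I. c u * F u x) \<in> X \<and>
         Q (\<lambda>x. \<Sum>u\<in>I. c u * F u x) = (\<lambda>x. \<Sum>u\<in>I. c u * Q (F u) x)"
  using \<open>finite I\<close> F
proof (induction I)
  case empty
  have z: "(\<lambda>x. 0) \<in> X" using X by (simp add: fun_subspace_def)
  have "\<forall>c. \<forall>f\<in>X. Q (\<lambda>x. c * f x) = (\<lambda>x. c * Q f x)"
    using Q by (simp add: projection_onto_def)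
  from this[rule_format, OF z, of 0] show ?case using z by simp
next
  case (insert v I)
  have v: "(\<lambda>x. c v * F v x) \<in> X" "Q (\<lambda>x. c v * F v x) = (\<lambda>x. c v * Q (F v) x)"
    using X Q insert.prems[of v] by (simp_all add: fun_subspace_def projection_onto_def)
  have IH: "(\<lambda>x. \<Sum>u\<in>I. c u * F u x) \<in> X"
    "Q (\<lambda>x. \<Sum>u\<in>I. c u * F u x) = (\<lambda>x. \<Sum>u\<in>I. c u * Q (F u) x)"
    using insert by auto
  have "\<forall>f\<in>X. \<forall>g\<in>X. Q (\<lambda>x. f x + g x) = (\<lambda>x. Q f x + Q g x)"
    using Q by (simp add: projection_onto_def)
  from this[rule_format, OF v(1) IH(1)]
  have "Q (\<lambda>x. c v * F v x + (\<Sum>u\<in>I. c u * F u x)) =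
      (\<lambda>x. c v * Q (F v) x + (\<Sum>u\<in>I. c u * Q (F u) x))"
    by (simp only: v(2) IH(2))
  moreover have "(\<lambda>x. c v * F v x + (\<Sum>u\<in>I. c u * F u x)) \<in> X"
    using X[unfolded fun_subspace_def, THEN conjunct2, THEN conjunct1, rule_format, OF v(1) IH(1)] .
  ultimately show ?case using insert.hyps by simp
qed

section \<open>Quadratic forms\<close>

text \<open>
  On the segment from \<open>0\<close> to \<open>w\<close> the form is \<open>s\<^sup>2 q(w)\<close>, whose slope tends to
  \<open>2 q(w)\<close> at the end point. If this exceeded the Lipschitz constant, so would a
  difference quotient between \<open>w\<close> and a nearby point of the segment.
\<close>

lemma quadratic_form_le_half_lip_norm:
  assumes q: "q \<in> hom_poly2_ball" and w: "norm (w :: real ^ 'n) = 1"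
  shows "2 * \<bar>q w\<bar> \<le> lip_norm q"
proof (rule ccontr)
  assume neg: "\<not> ?thesis"
  obtain M where M: "bilinear M" and qM: "q = ball_restrict (\<lambda>x. M x x)"
    using q by (auto simp: hom_poly2_ball_def hom_poly2_def)
  have qL: "q \<in> Lip0" using q hom_poly2_ball_subset_C10 C10_subset_Lip0 by blast
  define L where "L = lip_norm q"
  define a where "a = 2 * \<bar>q w\<bar>"
  have L0: "0 \<le> L" unfolding L_def by (rule lip_norm_nonneg[OF qL])
  have aL: "L < a" using neg by (simp add: a_def L_def)
  \<comment> \<open>The difference quotient between \<open>s w\<close> and \<open>w\<close> is \<open>(1 + s) a / 2\<close>; for this
    \<open>s\<close> it is the mean of \<open>a\<close> and \<open>L\<close>, hence still above \<open>L\<close>.\<close>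
  define s where "s = L / a"
  have s: "0 \<le> s" "s < 1" using L0 aL by (auto simp: s_def divide_simps)
  have qs: "q (s *\<^sub>R w) = s\<^sup>2 * q w"
    using s w by (simp add: qM ball_restrict_def bilinear_lmul[OF M] bilinear_rmul[OF M]
        power2_eq_square)
  have "\<bar>q w - q (s *\<^sub>R w)\<bar> \<le> L * norm (w - s *\<^sub>R w)"
    unfolding L_def using s w by (intro Lip0_diff_le_lip_norm qL) auto
  also have "w - s *\<^sub>R w = (1 - s) *\<^sub>R w" by (simp add: algebra_simps)
  also have "norm \<dots> = 1 - s" using s w by simp
  also have "q w - q (s *\<^sub>R w) = (1 - s) * ((1 + s) * q w)"
    by (simp add: qs power2_eq_square algebra_simps)
  also have "\<bar>\<dots>\<bar> = (1 - s) * ((1 + s) * \<bar>q w\<bar>)" using s by (simp add: abs_mult)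
  finally have "(1 + s) * \<bar>q w\<bar> \<le> L" using s by (simp add: mult.commute)
  moreover have "(1 + s) * \<bar>q w\<bar> = (a + L) / 2" using aL L0 by (simp add: s_def a_def field_simps)
  ultimately show False using aL by simp
qed

text \<open>
  The difference of values of \<open>q\<close> is, by polarisation, the \<open>(i,j)\<close> entry of its
  symmetric matrix; in this form it depends linearly on \<open>q\<close> alone, and the points of
  evaluation lie in the ball. The sum over all \<open>i, j\<close> would be \<open>n q(u / sqrt n)\<close>
  and the diagonal contributes \<open>n\<close> values of \<open>q\<close> at unit vectors, so each part is at
  most \<open>n/2\<close> times the Lipschitz norm.
\<close>

lemma off_diagonal_sum_le:
  fixes q :: "real ^ 'n \<Rightarrow> real"
  assumes q: "q \<in> hom_poly2_ball" and u: "\<And>i. u i = 1 \<or> u i = - 1"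
  shows "\<bar>\<Sum>i\<in>UNIV. \<Sum>j\<in>UNIV - {i}. u i * u j *
            (q ((1/2) *\<^sub>R (axis i 1 + axis j 1)) - q ((1/2) *\<^sub>R (axis i 1 - axis j 1)))\<bar>
         \<le> real CARD('n) * lip_norm q"
proof -
  obtain M where M: "bilinear M" and qM: "q = ball_restrict (\<lambda>x. M x x)"
    using q by (auto simp: hom_poly2_ball_def hom_poly2_def)
  note Msimps = bilinear_ladd[OF M] bilinear_radd[OF M] bilinear_lsub[OF M] bilinear_rsub[OF M]
    bilinear_lmul[OF M] bilinear_rmul[OF M]
  define m where "m i j = M (axis i 1) (axis j 1)" for i j
  define w where "w = (\<chi> i. u i)"
  let ?n = "real CARD('n)"
  have uu: "u i * u i = 1" for i using u[of i] by auto
  have polar: "q ((1/2) *\<^sub>R (axis i 1 + axis j 1)) - q ((1/2) *\<^sub>R (axis i 1 - axis j 1))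
      = (m i j + m j i) / 2" for i j
  proof -
    have "norm (axis i 1 + axis j 1 :: real ^ 'n) \<le> 2" "norm (axis i 1 - axis j 1 :: real ^ 'n) \<le> 2"
      using norm_triangle_ineq[of "axis i (1::real)" "axis j 1"]
        norm_triangle_ineq4[of "axis i (1::real)" "axis j 1"] by simp_all
    then show ?thesis by (simp add: qM ball_restrict_def Msimps m_def) (simp add: field_simps)
  qed
  have diag: "\<bar>m i i\<bar> \<le> lip_norm q / 2" for i
    using quadratic_form_le_half_lip_norm[OF q, of "axis i 1"]
    by (simp add: qM ball_restrict_def m_def)
  have nw: "norm w = sqrt ?n"
    by (simp add: w_def norm_vec_def L2_set_def power2_eq_square uu)
  have Mw: "M w w = (\<Sum>i\<in>UNIV. \<Sum>j\<in>UNIV. u i * u j * m i j)"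
  proof -
    have "w = (\<Sum>i\<in>UNIV. u i *\<^sub>R axis i 1)"
      using basis_expansion[of w] by (simp add: w_def scalar_mult_eq_scaleR)
    then have "M w w = M (\<Sum>i\<in>UNIV. u i *\<^sub>R axis i 1) (\<Sum>i\<in>UNIV. u i *\<^sub>R axis i 1)" by simp
    also have "\<dots> = (\<Sum>i\<in>UNIV. \<Sum>j\<in>UNIV. u i * u j * m i j)"
      by (simp add: bilinear_sum[OF M] sum.cartesian_product Msimps m_def mult.assoc
          mult.left_commute)
    finally show ?thesis .
  qed
  have "q ((1 / sqrt ?n) *\<^sub>R w) = M w w / ?n"
    using nw by (simp add: qM ball_restrict_def Msimps)
  moreover have "2 * \<bar>q ((1 / sqrt ?n) *\<^sub>R w)\<bar> \<le> lip_norm q"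
    by (rule quadratic_form_le_half_lip_norm[OF q]) (simp add: nw)
  ultimately have "?n * (2 * \<bar>M w w / ?n\<bar>) \<le> ?n * lip_norm q"
    by (intro mult_left_mono) simp_all
  then have full: "\<bar>M w w\<bar> \<le> ?n * (lip_norm q / 2)" by simp
  have swap: "(\<Sum>i\<in>UNIV. \<Sum>j\<in>UNIV. u i * u j * m j i) = M w w"
    unfolding Mw by (subst sum.swap) (simp add: mult.commute)
  have "(\<Sum>i\<in>UNIV. \<Sum>j\<in>UNIV. u i * u j * ((m i j + m j i) / 2))
      = ((\<Sum>i\<in>UNIV. \<Sum>j\<in>UNIV. u i * u j * m i j) + (\<Sum>i\<in>UNIV. \<Sum>j\<in>UNIV. u i * u j * m j i)) / 2"
    by (simp add: sum.distrib[symmetric] sum_divide_distrib algebra_simps)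
  also have "\<dots> = M w w" by (simp add: swap Mw[symmetric])
  finally have "(\<Sum>i\<in>UNIV. \<Sum>j\<in>UNIV - {i}. u i * u j * ((m i j + m j i) / 2))
      = M w w - (\<Sum>i\<in>UNIV. m i i)"
    by (simp add: sum_diff1 sum_subtractf uu)
  moreover have "\<bar>\<Sum>i\<in>UNIV. m i i\<bar> \<le> ?n * (lip_norm q / 2)"
    using order_trans[OF sum_abs sum_mono[of UNIV "\<lambda>i. \<bar>m i i\<bar>" "\<lambda>_. lip_norm q / 2"]] diag
    by simp
  ultimately show ?thesis using full unfolding polar by linarith
qed

section \<open>The test functions\<close>

definition sign_vectors :: "('n::finite \<Rightarrow> real) set" where
  "sign_vectors = (\<Pi>\<^sub>E k\<in>UNIV. {- 1, 1})"

definition riesz :: "('n::finite \<Rightarrow> real) \<Rightarrow> real ^ 'n \<Rightarrow> complex" where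
  "riesz u x = (\<Prod>k\<in>UNIV. Complex 1 (u k * x $ k))"

lemma finite_sign_vectors [simp]: "finite (sign_vectors :: ('n::finite \<Rightarrow> real) set)"
  unfolding sign_vectors_def by (intro finite_PiE) auto

lemma sign_vectorsD: "u \<in> sign_vectors \<Longrightarrow> u i = 1 \<or> u i = - 1"
  by (auto simp: sign_vectors_def PiE_iff)

lemma card_sign_vectors: "card (sign_vectors :: ('n::finite \<Rightarrow> real) set) = 2 ^ CARD('n)"
  unfolding sign_vectors_def by (subst card_PiE) (auto simp: card_insert_if numeral_2_eq_2)

text \<open>
  The sum over the signs factorises over the coordinates. Averaging \<open>1 + \<i> s t\<close> over
  \<open>s = \<plusminus>1\<close> leaves \<open>1\<close>, and averaging \<open>s (1 + \<i> s t)\<close> leaves \<open>\<i> t\<close>; the latter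
  occurs exactly at the coordinates \<open>i\<close> and \<open>j\<close>.
\<close>

lemma sum_signs_riesz:
  fixes x :: "real ^ 'n"
  assumes ij: "i \<noteq> j"
  shows "(\<Sum>u\<in>sign_vectors. of_real (u i * u j) * riesz u x)
       = - of_real (2 ^ CARD('n) * (x $ i * x $ j))"
proof -
  define h where "h k s = (if k = i \<or> k = j then of_real s else 1) * Complex 1 (s * x $ k)"
    for k and s :: real
  have "of_real (u i * u j) * riesz u x = (\<Prod>k\<in>UNIV. h k (u k))" for u
  proof -
    have "(\<Prod>k\<in>UNIV. if k = i \<or> k = j then complex_of_real (u k) else 1)
        = (\<Prod>k\<in>{i, j}. of_real (u k))"
      by (rule prod.mono_neutral_cong_right) auto
    then show ?thesis unfolding h_def riesz_def prod.distrib using ij by simp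
  qed
  then have "(\<Sum>u\<in>sign_vectors. of_real (u i * u j) * riesz u x)
      = (\<Sum>u\<in>sign_vectors. \<Prod>k\<in>UNIV. h k (u k))" by simp
  also have "\<dots> = (\<Prod>k\<in>UNIV. \<Sum>s\<in>{- 1, 1}. h k s)"
    unfolding sign_vectors_def by (rule prod_sum_PiE[symmetric]) auto
  also have "\<dots> = (\<Prod>k\<in>UNIV. 2 * (if k = i \<or> k = j then \<i> * of_real (x $ k) else 1))"
    by (intro prod.cong) (auto simp: h_def complex_eq_iff)
  also have "\<dots> = 2 ^ CARD('n) * (\<Prod>k\<in>UNIV. if k = i \<or> k = j then \<i> * of_real (x $ k) else 1)"
    by (simp add: prod.distrib)
  also have "(\<Prod>k\<in>UNIV. if k = i \<or> k = j then \<i> * of_real (x $ k) else 1)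
      = (\<Prod>k\<in>{i, j}. \<i> * of_real (x $ k))"
    by (rule prod.mono_neutral_cong_right) auto
  also have "\<dots> = - of_real (x $ i * x $ j)" using ij by (simp add: algebra_simps)
  finally show ?thesis by simp
qed

text \<open>
  Up to a factor of modulus one these are the partial derivatives of the Riesz product.
  The bound does not grow with the dimension, since
  \<open>\<Prod>\<^sub>k (1 + x\<^sub>k\<^sup>2) \<le> exp (|x|\<^sup>2)\<close>.
\<close>

lemma partial_riesz_bound:
  fixes x :: "real ^ 'n"
  assumes u: "u \<in> sign_vectors" and x: "x \<in> cball 0 1"
  shows "norm (\<Prod>k\<in>UNIV - {j}. Complex 1 (u k * x $ k)) \<le> sqrt (exp 1)"
proof -
  have factor: "norm (Complex 1 (u k * x $ k)) = sqrt (1 + (x $ k)\<^sup>2)" for k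
    using sign_vectorsD[OF u, of k] by (auto simp: cmod_def)
  have "norm (\<Prod>k\<in>UNIV - {j}. Complex 1 (u k * x $ k)) = (\<Prod>k\<in>UNIV - {j}. sqrt (1 + (x $ k)\<^sup>2))"
    by (simp add: prod_norm[symmetric] factor)
  also have "\<dots> \<le> (\<Prod>k\<in>UNIV. sqrt (1 + (x $ k)\<^sup>2))"
    by (rule prod_mono2) auto
  also have "\<dots> \<le> (\<Prod>k\<in>UNIV. sqrt (exp ((x $ k)\<^sup>2)))"
    by (intro prod_mono) auto
  also have "\<dots> = sqrt (exp (\<Sum>k\<in>UNIV. (x $ k)\<^sup>2))"
  proof -
    have "sqrt (exp t) = exp (t / 2)" for t :: real
      using exp_double[of "t / 2"] by (intro real_sqrt_unique) simp_all
    then show ?thesis by (simp add: sum_divide_distrib flip: exp_sum)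
  qed
  also have "(\<Sum>k\<in>UNIV. (x $ k)\<^sup>2) = (norm x)\<^sup>2"
    by (simp add: norm_vec_def L2_set_def sum_nonneg)
  also have "sqrt (exp ((norm x)\<^sup>2)) \<le> sqrt (exp 1)"
    using x by (simp add: power_le_one)
  finally show ?thesis .
qed

text \<open>
  Subtracting \<open>1\<close> makes the function vanish at the origin; the denominator is the
  bound for the Lipschitz constant of \<open>Re (riesz u)\<close>.
\<close>

definition test_fun :: "('n::finite \<Rightarrow> real) \<Rightarrow> real ^ 'n \<Rightarrow> real" where
  "test_fun u = ball_restrict (\<lambda>x. (Re (riesz u x) - 1) / sqrt (real CARD('n) * exp 1))"

lemma test_fun_properties:
  assumes u: "u \<in> sign_vectors"
  shows "test_fun u \<in> C10" "lip_norm (test_fun u :: real ^ 'n \<Rightarrow> real) \<le> 1"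
proof -
  define c where "c = 1 / sqrt (real CARD('n) * exp 1)"
  have c0: "0 < c" by (simp add: c_def)
  define f :: "real ^ 'n \<Rightarrow> real" where "f x = c * (Re (riesz u x) - 1)" for x
  define p where "p x j = (\<Prod>k\<in>UNIV - {j}. Complex 1 (u k * x $ k))" for x :: "real ^ 'n" and j
  define G :: "real ^ 'n \<Rightarrow> real ^ 'n" where "G x = (\<chi> j. c * Re (\<i> * of_real (u j) * p x j))" for x
  have cplx: "Complex 1 t = 1 + \<i> * of_real t" for t by (simp add: complex_eq_iff)
  have tf: "test_fun u = ball_restrict f" by (simp add: test_fun_def f_def[abs_def] c_def)
  have D: "(f has_derivative (\<lambda>h. inner h (G x))) (at x within S)" for x S
  proof -
    have "((\<lambda>x. \<Prod>k\<in>UNIV. 1 + \<i> * of_real (u k * x $ k)) has_derivative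
        (\<lambda>h. \<Sum>j\<in>UNIV. \<i> * of_real (u j * h $ j) * (\<Prod>k\<in>UNIV - {j}. 1 + \<i> * of_real (u k * x $ k))))
        (at x within S)"
      by (rule has_derivative_prod) (auto intro!: derivative_eq_intros bounded_linear_imp_has_derivative[OF bounded_linear_vec_nth])
    then have "(riesz u has_derivative (\<lambda>h. \<Sum>j\<in>UNIV. \<i> * of_real (u j * h $ j) * p x j)) (at x within S)"
      by (simp add: riesz_def[abs_def] p_def cplx)
    then have "(f has_derivative (\<lambda>h. c * (Re (\<Sum>j\<in>UNIV. \<i> * of_real (u j * h $ j) * p x j) - 0)))
        (at x within S)"
      unfolding f_def[abs_def]
      by (intro has_derivative_mult_right has_derivative_diff has_derivative_const has_derivative_Re)
    also have "(\<lambda>h. c * (Re (\<Sum>j\<in>UNIV. \<i> * of_real (u j * h $ j) * p x j) - 0)) = (\<lambda>h. inner h (G x))"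
      by (simp add: fun_eq_iff inner_vec_def G_def sum_distrib_left algebra_simps)
    finally show ?thesis .
  qed
  have nG: "norm (G x) \<le> 1" if x: "x \<in> cball 0 1" for x
  proof -
    have "norm (G x $ j) \<le> c * sqrt (exp 1)" for j
    proof -
      have "\<bar>Re (\<i> * of_real (u j) * p x j)\<bar> \<le> norm (\<i> * of_real (u j) * p x j)"
        by (rule abs_Re_le_cmod)
      also have "\<dots> = norm (p x j)" using sign_vectorsD[OF u, of j] by (auto simp: norm_mult)
      also have "\<dots> \<le> sqrt (exp 1)" unfolding p_def by (rule partial_riesz_bound[OF u x])
      finally show ?thesis using c0 by (simp add: G_def abs_mult)
    qed
    then have "norm (G x) \<le> L2_set (\<lambda>j::'n. c * sqrt (exp 1)) UNIV"
      unfolding norm_vec_def by (intro L2_set_mono) auto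
    also have "\<dots> = 1"
      using c0 by (simp add: L2_set_constant c_def real_sqrt_mult)
    finally show ?thesis .
  qed
  have "1-lipschitz_on (cball 0 1) f"
  proof (rule bounded_derivative_imp_lipschitz[OF D])
    fix x :: "real ^ 'n" assume x: "x \<in> cball 0 1"
    show "onorm (\<lambda>h. inner h (G x)) \<le> 1"
    proof (rule onorm_le)
      fix h :: "real ^ 'n"
      have "norm (inner h (G x)) \<le> norm h * norm (G x)"
        using Cauchy_Schwarz_ineq2 by simp
      also have "\<dots> \<le> norm h * 1" using nG[OF x] by (intro mult_left_mono) auto
      finally show "norm (inner h (G x)) \<le> 1 * norm h" by simp
    qed
  qed auto
  then have L: "1-lipschitz_on (cball 0 1) (test_fun u)"
    by (rule lipschitz_on_transform) (simp add: tf ball_restrict_def)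
  then show "lip_norm (test_fun u) \<le> 1" by (rule lip_norm_le)
  have contG: "continuous_on S G" for S
    unfolding G_def[abs_def] p_def cplx
    by (intro continuous_intros)
  have "uniformly_continuous_on (cball 0 1) G"
    by (rule compact_uniformly_continuous[OF contG compact_cball])
  then have "uniformly_continuous_on (ball 0 1) G"
    unfolding uniformly_continuous_on_def by (meson in_mono ball_subset_cball)
  moreover have "GDERIV (test_fun u) x :> G x" if "x \<in> ball 0 1" for x
    unfolding gderiv_def
    by (rule has_derivative_transform_within_open[of f _ x UNIV "ball 0 1"])
      (use that D in \<open>auto simp: tf ball_restrict_def\<close>)
  moreover have "test_fun u 0 = 0"
    by (simp add: tf ball_restrict_def f_def riesz_def cplx)
  moreover have "test_fun u \<in> ball_funs" by (simp add: tf ball_restrict_def ball_funs_def)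
  ultimately show "test_fun u \<in> C10"
    using lipschitz_on_continuous_on[OF L] by (intro C10I)
qed

lemma sum_signs_test_fun:
  assumes ij: "i \<noteq> j"
  shows "(\<lambda>x :: real ^ 'n. \<Sum>u\<in>sign_vectors. u i * u j * test_fun u x)
       = ball_restrict (\<lambda>x. - (2 ^ CARD('n) / sqrt (real CARD('n) * exp 1)) * (x $ i * x $ j))"
proof
  fix x :: "real ^ 'n"
  let ?s = "sqrt (real CARD('n) * exp 1)"
  have R: "(\<Sum>u\<in>sign_vectors. u i * u j * Re (riesz u y)) = - (2 ^ CARD('n) * (y $ i * y $ j))"
    for y :: "real ^ 'n"
    using arg_cong[OF sum_signs_riesz[OF ij, of y], of Re] by (simp flip: of_real_mult)
  \<comment> \<open>Evaluation at the origin shows that the constant \<open>1\<close> drops out of the signed sum.\<close>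
  have "riesz u 0 = 1" for u :: "'n \<Rightarrow> real" by (simp add: riesz_def flip: one_complex.code)
  then have Z: "(\<Sum>u\<in>sign_vectors. u i * u j) = 0" using R[of 0] by simp
  show "(\<Sum>u\<in>sign_vectors. u i * u j * test_fun u x)
      = ball_restrict (\<lambda>x. - (2 ^ CARD('n) / ?s) * (x $ i * x $ j)) x"
  proof (cases "x \<in> cball 0 1")
    case True
    have "(\<Sum>u\<in>sign_vectors. u i * u j * test_fun u x)
        = ((\<Sum>u\<in>sign_vectors. u i * u j * Re (riesz u x)) - (\<Sum>u\<in>sign_vectors. u i * u j)) / ?s"
      using True by (simp add: test_fun_def ball_restrict_def sum_subtractf[symmetric]
          sum_divide_distrib right_diff_distrib)
    then show ?thesis using True by (simp add: R Z ball_restrict_def)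
  qed (simp add: test_fun_def ball_restrict_def)
qed

section \<open>The lower bound\<close>

text \<open>
  The images \<open>q u\<close> of the test functions have matrices whose entries are prescribed on
  average over the signs, and this average is too large unless some \<open>q u\<close> has large
  Lipschitz norm.
\<close>

theorem op_norm_projection_lower_bound:
  fixes Q :: "(real ^ 'n \<Rightarrow> real) \<Rightarrow> (real ^ 'n \<Rightarrow> real)"
  assumes Q: "projection_onto X hom_poly2_ball Q"
    and X: "fun_subspace X" "C10 \<subseteq> X" "X \<subseteq> Lip0"
  shows "(real CARD('n) - 1) / (2 * sqrt (real CARD('n) * exp 1)) \<le> op_norm X Q"
proof -
  let ?n = "real CARD('n)"
  let ?U = "sign_vectors :: ('n \<Rightarrow> real) set"
  define c where "c = 2 ^ CARD('n) / sqrt (?n * exp 1)"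
  define q where "q u = Q (test_fun u)" for u :: "'n \<Rightarrow> real"
  define b where "b u i j = q u ((1/2) *\<^sub>R (axis i 1 + axis j 1))
      - q u ((1/2) *\<^sub>R (axis i 1 - axis j 1))" for u i j
  have tX: "test_fun u \<in> X" if "u \<in> ?U" for u
    using test_fun_properties(1)[OF that] X(2) by blast
  have range: "Q ` X = hom_poly2_ball" and idem: "\<forall>f\<in>X. Q (Q f) = Q f"
    using Q by (auto simp: projection_onto_def)
  have coeff: "(\<Sum>u\<in>?U. u i * u j * b u i j) = - c / 2" if ij: "i \<noteq> j" for i j
  proof -
    define P where "P = ball_restrict (\<lambda>x :: real ^ 'n. - c * (x $ i * x $ j))"
    have "bilinear (\<lambda>x y :: real ^ 'n. - c * (x $ i * y $ j))"
      by (auto simp: bilinear_def linear_iff algebra_simps)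
    then have "P \<in> hom_poly2_ball"
      unfolding P_def hom_poly2_ball_def hom_poly2_def by blast
    then have "Q P = P" using idem unfolding range[symmetric] by blast
    moreover have "(\<lambda>x. \<Sum>u\<in>?U. u i * u j * test_fun u x) = P"
      unfolding P_def c_def by (rule sum_signs_test_fun[OF ij])
    ultimately have P: "(\<Sum>u\<in>?U. u i * u j * q u x) = P x" for x
      using projection_onto_sum[OF Q X(1) finite_sign_vectors, of test_fun "\<lambda>u. u i * u j"] tX
      by (simp add: q_def fun_eq_iff)
    have "norm (axis i 1 + axis j 1 :: real ^ 'n) \<le> 2" "norm (axis i 1 - axis j 1 :: real ^ 'n) \<le> 2"
      using norm_triangle_ineq[of "axis i (1::real)" "axis j 1"]
        norm_triangle_ineq4[of "axis i (1::real)" "axis j 1"] by simp_all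
    then show ?thesis
      using ij by (simp add: b_def right_diff_distrib sum_subtractf P)
        (simp add: P_def ball_restrict_def axis_def)
  qed
  have "(\<Sum>u\<in>?U. \<Sum>i\<in>UNIV. \<Sum>j\<in>UNIV - {i}. u i * u j * b u i j)
      = (\<Sum>i\<in>UNIV. \<Sum>j\<in>UNIV - {i}. \<Sum>u\<in>?U. u i * u j * b u i j)"
    by (subst sum.swap) (intro sum.cong refl sum.swap)
  also have "\<dots> = (\<Sum>i\<in>(UNIV :: 'n set). \<Sum>j\<in>UNIV - {i}. - c / 2)"
    by (intro sum.cong refl coeff) auto
  also have "\<dots> = - (?n * (?n - 1) * c / 2)"
    by (simp add: card_Diff_singleton of_nat_diff)
  finally have "?n * (?n - 1) * c / 2
      \<le> \<bar>\<Sum>u\<in>?U. \<Sum>i\<in>UNIV. \<Sum>j\<in>UNIV - {i}. u i * u j * b u i j\<bar>" by linarith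
  also have "\<dots> \<le> (\<Sum>u\<in>?U. \<bar>\<Sum>i\<in>UNIV. \<Sum>j\<in>UNIV - {i}. u i * u j * b u i j\<bar>)"
    by (rule sum_abs)
  also have "\<dots> \<le> (\<Sum>u\<in>?U. ?n * op_norm X Q)"
  proof (rule sum_mono)
    fix u assume u: "u \<in> ?U"
    have "q u \<in> hom_poly2_ball" unfolding q_def using tX[OF u] range by blast
    then have "\<bar>\<Sum>i\<in>UNIV. \<Sum>j\<in>UNIV - {i}. u i * u j * b u i j\<bar> \<le> ?n * lip_norm (q u)"
      unfolding b_def by (rule off_diagonal_sum_le) (rule sign_vectorsD[OF u])
    also have "lip_norm (q u) \<le> op_norm X Q"
      unfolding q_def by (rule lip_norm_le_op_norm[OF Q X(3) tX[OF u] test_fun_properties(2)[OF u]])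
    finally show "\<bar>\<Sum>i\<in>UNIV. \<Sum>j\<in>UNIV - {i}. u i * u j * b u i j\<bar> \<le> ?n * op_norm X Q"
      by simp
  qed
  also have "\<dots> = 2 ^ CARD('n) * (?n * op_norm X Q)" by (simp add: card_sign_vectors)
  finally have "2 ^ CARD('n) * ?n * ((?n - 1) / (2 * sqrt (?n * exp 1)))
      \<le> 2 ^ CARD('n) * ?n * op_norm X Q"
    by (simp add: c_def ac_simps)
  then show ?thesis by (subst (asm) mult_le_cancel_left_pos) auto
qed

text \<open>
  The fifth root of \<open>n - 2 sqrt 2\<close> is negative for \<open>n = 1\<close> and at most \<open>sqrt (n - 1)\<close>
  for \<open>n \<ge> 2\<close>, and the crude bounds \<open>4/25\<close> for the constant and \<open>3\<close> for \<open>e\<close> leave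
  enough room.
\<close>

lemma fifth_root_bound:
  fixes n :: real
  assumes n: "n = 1 \<or> 2 \<le> n"
  shows "2 / 5 * root 5 ((sqrt 2 - 1) / 3 * (pi / 72)) * root 5 (n - 2 * sqrt 2)
      \<le> (n - 1) / (2 * sqrt (n * exp 1))"
proof -
  let ?C = "2 / 5 * root 5 ((sqrt 2 - 1) / 3 * (pi / 72))"
  have s2: "1 \<le> sqrt 2" "1 \<le> 2 * sqrt 2" "sqrt 2 \<le> 3 / 2"
  proof -
    show "1 \<le> sqrt 2" by simp
    then show "1 \<le> 2 * sqrt 2" by linarith
    show "sqrt 2 \<le> 3 / 2" by (rule real_le_lsqrt) (auto simp: power2_eq_square)
  qed
  have C0: "0 \<le> ?C" using s2 pi_gt_zero by simp
  have "(sqrt 2 - 1) / 3 * (pi / 72) \<le> (1 / 2) / 3 * (4 / 72)"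
    using s2 pi_less_4 pi_gt_zero by (intro mult_mono) auto
  also have "\<dots> \<le> (2 / 5) ^ 5" by (simp add: power_divide)
  finally have "root 5 ((sqrt 2 - 1) / 3 * (pi / 72)) \<le> root 5 ((2 / 5) ^ 5)"
    by (intro real_root_le_mono) auto
  then have C1: "?C \<le> 4 / 25" by (simp add: real_root_power_cancel)
  from n show ?thesis
  proof
    assume "n = 1"
    have "root 5 (n - 2 * sqrt 2) \<le> 0" using s2 \<open>n = 1\<close> by (simp del: one_le_numeral)
    then show ?thesis using C0 \<open>n = 1\<close> by (simp add: mult_nonneg_nonpos)
  next
    assume n2: "2 \<le> n"
    have "root 5 (n - 2 * sqrt 2) \<le> root 5 (n - 1)"
      using s2 by (intro real_root_le_mono) auto
    also have "\<dots> \<le> sqrt (n - 1)"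
      unfolding sqrt_def using n2 by (intro real_root_decreasing) auto
    finally have "?C * root 5 (n - 2 * sqrt 2) \<le> ?C * sqrt (n - 1)"
      using C0 by (rule mult_left_mono)
    also have "\<dots> \<le> 4 / 25 * sqrt (n - 1)"
      using C1 n2 by (intro mult_right_mono) auto
    also have "\<dots> \<le> (n - 1) / (2 * sqrt (n * exp 1))"
    proof -
      have "n * exp 1 \<le> n * 3" using n2 exp_le by (intro mult_left_mono) auto
      also have "\<dots> \<le> 9 * (n - 1)" using n2 by simp
      finally have "sqrt (n * exp 1) \<le> sqrt (9 * (n - 1))" by (rule real_sqrt_le_mono)
      also have "\<dots> = 3 * sqrt (n - 1)" using real_sqrt_mult[of 9 "n - 1"] by simp
      finally have "sqrt (n - 1) * sqrt (n * exp 1) \<le> sqrt (n - 1) * (3 * sqrt (n - 1))"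
        using n2 by (intro mult_left_mono) auto
      also have "\<dots> = 3 * (n - 1)"
        using n2 real_sqrt_mult_self[of "n - 1"] by (simp only: mult.left_commute)
      finally show ?thesis using n2 by (simp add: pos_le_divide_eq)
    qed
    finally show ?thesis .
  qed
qed

theorem theoremA:
  fixes C :: real
  assumes C: "C = 2 / 5 * root 5 ((sqrt 2 - 1) / 3 * (pi / 72))"
  shows "(\<forall>Q :: (real ^ 'n \<Rightarrow> real) \<Rightarrow> (real ^ 'n \<Rightarrow> real).
            projection_onto C10 hom_poly2_ball Q \<longrightarrow>
            op_norm C10 Q \<ge> C * root 5 (real CARD('n) - 2 * sqrt 2)) \<and>
         (\<forall>Q :: (real ^ 'n \<Rightarrow> real) \<Rightarrow> (real ^ 'n \<Rightarrow> real).
            projection_onto Lip0 hom_poly2_ball Q \<longrightarrow>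
            op_norm Lip0 Q \<ge> C * root 5 (real CARD('n) - 2 * sqrt 2))"
proof -
  have "0 < CARD('n)" by simp
  then have "CARD('n) = 1 \<or> 2 \<le> CARD('n)" by linarith
  then have "real CARD('n) = 1 \<or> 2 \<le> real CARD('n)" by auto
  note bound = fifth_root_bound[OF this, folded C]
  show ?thesis
    using order_trans[OF bound op_norm_projection_lower_bound] C10_subset_Lip0
      fun_subspace_C10 fun_subspace_Lip0 by blast
qed

end
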